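(* The diameter of $(O_n,g)$ is equal to $\sqrt{2\lfloor n/2\rfloor}\,\pi$.
   Context: $O_n$ is the group of real orthogonal matrices of order $n$ with the Riemannian metric $g(V,W)=\operatorname{tr}(V^TW)$ induced by the Frobenius metric, and $d$ is the associated Riemannian distance (on each of the connected components). The diameter is defined as $\operatorname{diam}(O_n,g)=\sup\{d(G,H) : G,H \text{ in the same connected component of } O_n\}$. *)

theory Defs
  imports "HOL-Analysis.Analysis"
begin

definition orthogonal_group :: "(real^'n^'n) set" where
  "orthogonal_group = {A. orthogonal_matrix A}"

definition frobenius_metric :: "real^'n^'n \<Rightarrow> real^'n^'n \<Rightarrow> real" where
  "frobenius_metric V W = trace (transpose V ** W)"

(* "piecewise_C1_differentiable_on" and "valid_path" of the library do not bound the derivative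
   near the break points, so the speed of such a path need not be integrable (and its "integral"
   would then be 0). Here each piece has to be C1 on the closed subinterval, with one-sided
   derivatives at the ends. *)
definition piecewise_C1_curve :: "(real \<Rightarrow> 'a::real_normed_vector) \<Rightarrow> bool" where
  "piecewise_C1_curve \<gamma> \<longleftrightarrow>
     (\<exists>(m::nat) t. t 0 = 0 \<and> t m = 1 \<and> (\<forall>i<m. t i < t (Suc i)) \<and>
        (\<forall>i<m. \<exists>\<gamma>'. continuous_on {t i..t (Suc i)} \<gamma>' \<and>
           (\<forall>s\<in>{t i..t (Suc i)}.
              (\<gamma> has_vector_derivative \<gamma>' s) (at s within {t i..t (Suc i)}))))"

(* At the finitely many break points the integrand may be an unspecified value,
   which does not affect the integral. *)
definition curve_length :: "('a \<Rightarrow> 'a \<Rightarrow> real) \<Rightarrow> (real \<Rightarrow> 'a::real_normed_vector) \<Rightarrow> real" where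
  "curve_length g \<gamma> =
     integral {0..1} (\<lambda>t. sqrt (g (vector_derivative \<gamma> (at t)) (vector_derivative \<gamma> (at t))))"

(* Distance on an embedded submanifold M of the ambient space, whose metric is the restriction
   of the constant form g to the tangent spaces of M: a curve with values in M is C1 into M iff
   it is C1 into the ambient space, and its velocity is then tangent to M.
   The distance is infinite if no piecewise C1 curve in M joins the points. *)
definition riemannian_dist ::
  "('a \<Rightarrow> 'a \<Rightarrow> real) \<Rightarrow> 'a::real_normed_vector set \<Rightarrow> 'a \<Rightarrow> 'a \<Rightarrow> ereal" where
  "riemannian_dist g M p q =
     Inf {ereal (curve_length g \<gamma>) |\<gamma>.
            piecewise_C1_curve \<gamma> \<and> \<gamma> ` {0..1} \<subseteq> M \<and> \<gamma> 0 = p \<and> \<gamma> 1 = q}"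

definition riemannian_diameter ::
  "('a \<Rightarrow> 'a \<Rightarrow> real) \<Rightarrow> 'a::real_normed_vector set \<Rightarrow> ereal" where
  "riemannian_diameter g M =
     Sup {riemannian_dist g M p q |p q. connected_component M p q}"

end

theory Submission imports Defs begin

text \<open>
  Upper bound: for \<open>P, Q\<close> in one component, \<open>P\<^sup>T Q\<close> has determinant 1, hence is a product of
  commuting rotations by angles \<open>\<theta>\<^sub>i \<in> [0, \<pi>]\<close> in at most \<open>\<lfloor>n/2\<rfloor>\<close> orthogonal planes. Rotating by
  \<open>t \<theta>\<^sub>i\<close> gives a curve from \<open>P\<close> to \<open>Q\<close> of constant speed \<open>sqrt (\<Sum>i. 2 \<theta>\<^sub>i\<^sup>2)\<close>.

  Lower bound: let \<open>Q\<close> be diagonal with \<open>m = 2 \<lfloor>n/2\<rfloor>\<close> entries \<open>-1\<close> and the others 1. Along a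
  curve from the identity to \<open>Q\<close>, each of the \<open>m\<close> corresponding rows runs on the unit sphere
  between antipodal points, a distance of at least \<open>\<pi>\<close>. By Cauchy-Schwarz the speed of the curve is
  at least \<open>1 / sqrt m\<close> times the sum of the speeds of these rows, so the length is at least
  \<open>sqrt m \<pi>\<close>.
\<close>

subsection \<open>A lower bound for the length of curves\<close>

lemma frobenius_metric_eq_inner: "frobenius_metric V W = V \<bullet> W"
proof -
  have "V \<bullet> W = (\<Sum>i\<in>UNIV. \<Sum>j\<in>UNIV. V$i$j * W$i$j)"
    by (simp add: inner_vec_def)
  also have "\<dots> = (\<Sum>j\<in>UNIV. \<Sum>i\<in>UNIV. V$i$j * W$i$j)"
    by (rule sum.swap)
  finally show ?thesis
    by (simp add: frobenius_metric_def trace_def matrix_matrix_mult_def transpose_def)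
qed

lemma curve_length_frobenius:
  "curve_length frobenius_metric \<gamma> = integral {0..1} (\<lambda>t. norm (vector_derivative \<gamma> (at t)))"
  by (simp add: curve_length_def frobenius_metric_eq_inner norm_eq_sqrt_inner)

text \<open>What integration along a piecewise C1 curve uses, in a form that can be glued at a
  common end point. The finite set \<open>S\<close> absorbs break points and interval ends, where
  the two-sided derivative may fail to exist.\<close>

definition C1_on_pieces :: "(real \<Rightarrow> 'a::real_normed_vector) \<Rightarrow> real \<Rightarrow> real \<Rightarrow> bool" where
  "C1_on_pieces \<gamma> a b \<longleftrightarrow> continuous_on {a..b} \<gamma> \<and>
     (\<exists>S. finite S \<and> (\<forall>t\<in>{a..b} - S. \<gamma> differentiable (at t))) \<and>
     (\<lambda>t. norm (vector_derivative \<gamma> (at t))) integrable_on {a..b}"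

lemma C1_on_pieces_combine:
  assumes "a \<le> b" "b \<le> c" "C1_on_pieces \<gamma> a b" "C1_on_pieces \<gamma> b c"
  shows "C1_on_pieces \<gamma> a c"
proof -
  have ac: "{a..c} = {a..b} \<union> {b..c}"
    using assms by auto
  obtain S T where "finite S" "\<forall>t\<in>{a..b} - S. \<gamma> differentiable (at t)"
    "finite T" "\<forall>t\<in>{b..c} - T. \<gamma> differentiable (at t)"
    using assms unfolding C1_on_pieces_def by metis
  then have "finite (S \<union> T) \<and> (\<forall>t\<in>{a..c} - (S \<union> T). \<gamma> differentiable (at t))"
    unfolding ac by auto
  moreover have "continuous_on {a..c} \<gamma>"
    unfolding ac using assms by (intro continuous_on_closed_Un) (auto simp: C1_on_pieces_def)
  moreover have "(\<lambda>t. norm (vector_derivative \<gamma> (at t))) integrable_on {a..c}"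
    using assms by (intro Henstock_Kurzweil_Integration.integrable_combine[of a b c]) (auto simp: C1_on_pieces_def)
  ultimately show ?thesis
    unfolding C1_on_pieces_def by blast
qed

lemma C1_on_pieces_single:
  assumes cont: "continuous_on {a..b} \<gamma>'"
    and deriv: "\<And>s. s \<in> {a..b} \<Longrightarrow> (\<gamma> has_vector_derivative \<gamma>' s) (at s within {a..b})"
  shows "C1_on_pieces \<gamma> a b"
proof -
  \<comment> \<open>At the ends of the interval only one-sided derivatives are given, while the
    speed is taken with the two-sided filter \<open>at s\<close>; the two ends are therefore
    exceptional.\<close>
  have D: "(\<gamma> has_vector_derivative \<gamma>' s) (at s)" if "s \<in> {a..b} - {a,b}" for s
  proof -
    have "at s within {a..b} = at s"
      using that by (intro at_within_interior) auto
    then show ?thesis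
      using deriv[of s] that by auto
  qed
  have "continuous_on {a..b} \<gamma>"
    by (meson continuous_on_eq_continuous_within deriv has_vector_derivative_continuous)
  moreover have "\<forall>t\<in>{a..b} - {a,b}. \<gamma> differentiable (at t)"
    using D differentiableI_vector by blast
  moreover have "(\<lambda>t. norm (vector_derivative \<gamma> (at t))) integrable_on {a..b}"
  proof (rule integrable_spike_finite)
    show "finite {a,b}" by simp
    show "norm (vector_derivative \<gamma> (at s)) = norm (\<gamma>' s)" if "s \<in> {a..b} - {a,b}" for s
      using D[OF that] vector_derivative_at by metis
    show "(\<lambda>s. norm (\<gamma>' s)) integrable_on {a..b}"
      by (intro integrable_continuous_real continuous_intros cont)
  qed
  ultimately show ?thesis
    unfolding C1_on_pieces_def by (meson finite.emptyI finite.insertI)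
qed

lemma piecewise_C1_curve_imp_C1_on_pieces:
  assumes "piecewise_C1_curve \<gamma>"
  shows "C1_on_pieces \<gamma> 0 1"
proof -
  obtain m :: nat and t where t: "t 0 = 0" "t m = 1" "\<And>i. i < m \<Longrightarrow> t i < t (Suc i)"
    and pieces: "\<And>i. i < m \<Longrightarrow> \<exists>\<gamma>'. continuous_on {t i..t (Suc i)} \<gamma>' \<and>
        (\<forall>s\<in>{t i..t (Suc i)}. (\<gamma> has_vector_derivative \<gamma>' s) (at s within {t i..t (Suc i)}))"
    using assms unfolding piecewise_C1_curve_def by metis
  have "j \<le> m \<Longrightarrow> 0 \<le> t j \<and> C1_on_pieces \<gamma> 0 (t j)" for j
  proof (induction j)
    case 0
    \<comment> \<open>The interval is the single point 0, which goes into the exceptional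
      set.\<close>
    have "C1_on_pieces \<gamma> 0 0"
      unfolding C1_on_pieces_def using integrable_on_refl[of _ "0::real"]
      by (auto intro!: exI[of _ "{0::real}"])
    then show ?case
      by (simp add: t)
  next
    case (Suc j)
    have "C1_on_pieces \<gamma> (t j) (t (Suc j))"
      using pieces[of j] Suc.prems C1_on_pieces_single by (metis Suc_le_lessD)
    then show ?case
      using Suc t(3)[of j] C1_on_pieces_combine[of 0 "t j" "t (Suc j)" \<gamma>] by simp
  qed
  from this[of m] show ?thesis
    by (simp add: t)
qed

text \<open>The fundamental theorem of calculus tolerates finitely many exceptional points, so the
  increment of \<open>F\<close> is the integral of its derivative, which \<open>bound\<close>
  compares with the speed of \<open>\<gamma>\<close>.\<close>

lemma increment_le_curve_length:
  fixes F :: "real \<Rightarrow> real"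
  assumes pieces: "C1_on_pieces \<gamma> 0 1"
    and cont: "continuous_on {0..1} F"
    and bound: "\<And>t D. \<lbrakk>0 < t; t < 1; (\<gamma> has_vector_derivative D) (at t)\<rbrakk>
       \<Longrightarrow> \<exists>F'. (F has_vector_derivative F') (at t) \<and> F' \<le> c * norm D"
  shows "F 1 - F 0 \<le> c * integral {0..1} (\<lambda>t. norm (vector_derivative \<gamma> (at t)))"
proof -
  obtain S where S: "finite S" "\<And>t. t \<in> {0..1} - S \<Longrightarrow> \<gamma> differentiable (at t)"
    and int: "(\<lambda>t. norm (vector_derivative \<gamma> (at t))) integrable_on {0..1}"
    using pieces unfolding C1_on_pieces_def by blast
  have F': "(F has_vector_derivative vector_derivative F (at t)) (at t) \<and>
      vector_derivative F (at t) \<le> c * norm (vector_derivative \<gamma> (at t))"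
    if "t \<in> {0<..<1} - S" for t
  proof -
    have "(\<gamma> has_vector_derivative vector_derivative \<gamma> (at t)) (at t)"
      using S(2)[of t] that vector_derivative_works by auto
    from bound[OF _ _ this] that show ?thesis
      using vector_derivative_at by fastforce
  qed
  have "((\<lambda>t. vector_derivative F (at t)) has_integral (F 1 - F 0)) {0..1}"
    by (rule fundamental_theorem_of_calculus_interior_strong[OF S(1)]) (use F' cont in auto)
  moreover have "((\<lambda>t. c * norm (vector_derivative \<gamma> (at t))) has_integral
      c * integral {0..1} (\<lambda>t. norm (vector_derivative \<gamma> (at t)))) {0..1}"
    using int by (intro has_integral_mult_right) (simp add: has_integral_integral)
  \<comment> \<open>On \<open>S \<union> {0,1}\<close> no bound on the derivative of
    \<open>F\<close> is available. The majorant is changed there to that derivative itself, so that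
    the comparison holds at every point.\<close>
  then have "((\<lambda>t. if t \<in> S \<union> {0,1} then vector_derivative F (at t)
      else c * norm (vector_derivative \<gamma> (at t))) has_integral
      c * integral {0..1} (\<lambda>t. norm (vector_derivative \<gamma> (at t)))) {0..1}"
    by (rule has_integral_spike_finite[rotated 2, where S = "S \<union> {0,1}"]) (use S in auto)
  ultimately show ?thesis
    by (rule has_integral_le) (use F' in auto)
qed

text \<open>As \<open>d\<close> is orthogonal to \<open>x\<close>, only the component of
  \<open>a\<close> orthogonal to \<open>x\<close> contributes to \<open>a \<bullet> d\<close>; its
  norm is the sine of the angle between \<open>a\<close> and \<open>x\<close>.\<close>

lemma abs_inner_unit_sphere_le:
  fixes a x d :: "'a::real_inner"
  assumes "norm a = 1" "norm x = 1" "x \<bullet> d = 0"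
  shows "\<bar>a \<bullet> d\<bar> \<le> sqrt (1 - (a \<bullet> x)\<^sup>2) * norm d"
proof -
  have "a \<bullet> d = (a - (a \<bullet> x) *\<^sub>R x) \<bullet> d"
    using assms by (simp add: inner_diff_left)
  moreover have "(norm (a - (a \<bullet> x) *\<^sub>R x))\<^sup>2 = 1 - (a \<bullet> x)\<^sup>2"
    using assms unfolding power2_norm_eq_inner
    by (simp add: inner_diff_left inner_diff_right norm_eq_1 inner_commute power2_eq_square)
  then have "norm (a - (a \<bullet> x) *\<^sub>R x) = sqrt (1 - (a \<bullet> x)\<^sup>2)"
    by (metis norm_ge_zero real_sqrt_unique)
  ultimately show ?thesis
    by (metis Cauchy_Schwarz_ineq2)
qed

text \<open>The factor \<open>r < 1\<close> keeps the argument away from the points where \<open>arccos\<close> is not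
  differentiable.\<close>

lemma arccos_inner_derivative_bound:
  fixes a :: "'a::real_inner"
  assumes "norm a = 1" "norm (c t) = 1" "c t \<bullet> d = 0" "0 < r" "r < 1"
    and c: "(c has_vector_derivative d) (at t)"
  shows "\<exists>D. ((\<lambda>s. arccos (r * (a \<bullet> c s))) has_vector_derivative D) (at t) \<and> D \<le> norm d"
proof -
  let ?y = "a \<bullet> c t"
  have y: "?y\<^sup>2 \<le> 1"
    using Cauchy_Schwarz_ineq2[of a "c t"] assms by (simp add: abs_square_le_1)
  have "r\<^sup>2 * ?y\<^sup>2 \<le> r\<^sup>2" "r\<^sup>2 < 1"
    using y \<open>0 < r\<close> \<open>r < 1\<close> by (auto simp: mult_left_le power_less_one_iff)
  \<comment> \<open>\<open>ry\<close> keeps the denominator in the derivative of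
    \<open>arccos\<close> positive. \<open>rr\<close> shows that this denominator is at least
    \<open>r\<close> times the sine \<open>sqrt (1 - ?y\<^sup>2)\<close> that bounds the
    numerator.\<close>
  then have ry: "(r * ?y)\<^sup>2 < 1" and rr: "r\<^sup>2 * (1 - ?y\<^sup>2) \<le> 1 - (r * ?y)\<^sup>2"
    by (simp_all add: power_mult_distrib algebra_simps)
  have "-1 < r * ?y" "r * ?y < 1"
    using ry by (auto simp: abs_square_less_1)
  have "((\<lambda>s. r * (a \<bullet> c s)) has_real_derivative r * (a \<bullet> d)) (at t)"
    unfolding has_real_derivative_iff_has_vector_derivative
    by (rule bounded_linear.has_vector_derivative[OF _ c])
      (intro bounded_linear_intros)
  from DERIV_chain2[OF DERIV_arccos this]
  have "((\<lambda>s. arccos (r * (a \<bullet> c s))) has_real_derivative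
      inverse (- sqrt (1 - (r * ?y)\<^sup>2)) * (r * (a \<bullet> d))) (at t)"
    using \<open>-1 < r * ?y\<close> \<open>r * ?y < 1\<close> by simp
  moreover have "inverse (- sqrt (1 - (r * ?y)\<^sup>2)) * (r * (a \<bullet> d)) \<le> norm d"
  proof -
    have pos: "0 < sqrt (1 - (r * ?y)\<^sup>2)"
      using ry by simp
    have "- (r * (a \<bullet> d)) \<le> r * \<bar>a \<bullet> d\<bar>"
      using \<open>0 < r\<close> by (smt (verit) mult_left_mono mult_minus_right)
    also have "\<dots> \<le> r * (sqrt (1 - ?y\<^sup>2) * norm d)"
      using abs_inner_unit_sphere_le[of a "c t" d] assms by (intro mult_left_mono) auto
    also have "\<dots> = sqrt (r\<^sup>2 * (1 - ?y\<^sup>2)) * norm d"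
      using \<open>0 < r\<close> by (simp add: real_sqrt_mult)
    also have "\<dots> \<le> sqrt (1 - (r * ?y)\<^sup>2) * norm d"
      using rr by (intro mult_right_mono) auto
    finally show ?thesis
      using pos by (simp add: field_simps)
  qed
  ultimately show ?thesis
    unfolding has_real_derivative_iff_has_vector_derivative by blast
qed

lemma norm_row_orthogonal_matrix:
  fixes A :: "real^'n^'n"
  assumes "orthogonal_matrix A"
  shows "norm (A $ i) = 1"
  using assms by (simp add: orthogonal_matrix_orthonormal_rows row_def vec_nth_inverse)

text \<open>Cauchy-Schwarz against the constant vector 1 on \<open>S\<close>, since the squared
  norms of all rows add up to the squared norm of \<open>V\<close>.\<close>

lemma sum_norm_rows_le:
  fixes V :: "real^'n^'n"
  shows "(\<Sum>i\<in>S. norm (V $ i)) \<le> sqrt (real (card S)) * norm V"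
proof -
  have "(\<Sum>i\<in>S. norm (V $ i)) \<le> L2_set (\<lambda>_. 1) S * L2_set (\<lambda>i. norm (V $ i)) S"
    using L2_set_mult_ineq[of "\<lambda>_. 1" "\<lambda>i. norm (V $ i)" S] by simp
  also have "\<dots> \<le> sqrt (real (card S)) * norm V"
    unfolding norm_vec_def L2_set_constant
    by (auto intro!: mult_left_mono real_sqrt_le_mono sum_mono2 simp: L2_set_def)
  finally show ?thesis .
qed

text \<open>Row \<open>i\<close> moves on the unit sphere, and \<open>arccos\<close> of its
  \<open>i\<close>-th entry is its angle to the \<open>i\<close>-th axis. The sum of these angles
  over \<open>S\<close> grows from 0 to \<open>card S * pi\<close>, at a rate of at most
  \<open>sqrt (card S)\<close> times the speed of \<open>\<gamma>\<close>. Scaling the entries by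
  \<open>r < 1\<close> makes the angles differentiable.\<close>

lemma curve_length_flip_coordinates_ge:
  fixes \<gamma> :: "real \<Rightarrow> real^'n^'n"
  assumes C1: "piecewise_C1_curve \<gamma>" and orth: "\<gamma> ` {0..1} \<subseteq> orthogonal_group"
    and start: "\<And>i. i \<in> S \<Longrightarrow> \<gamma> 0 $ i $ i = 1" and stop: "\<And>i. i \<in> S \<Longrightarrow> \<gamma> 1 $ i $ i = -1"
  shows "sqrt (real (card S)) * pi \<le> curve_length frobenius_metric \<gamma>"
proof (cases "S = {}")
  \<comment> \<open>Empty \<open>S\<close> occurs for matrices of order 1. The cancellation of
    \<open>sqrt (card S)\<close> at the end excludes it.\<close>
  case True
  have "0 \<le> integral {0..1} (\<lambda>t. norm (vector_derivative \<gamma> (at t)))"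
    using piecewise_C1_curve_imp_C1_on_pieces[OF C1]
    by (intro integral_nonneg) (auto simp: C1_on_pieces_def)
  with True show ?thesis
    by (simp add: curve_length_frobenius)
next
  case False
  then have S: "0 < real (card S)"
    by (simp add: card_gt_0_iff)
  let ?L = "curve_length frobenius_metric \<gamma>"
  have pieces: "C1_on_pieces \<gamma> 0 1"
    using C1 by (rule piecewise_C1_curve_imp_C1_on_pieces)
  have row: "norm (\<gamma> t $ i) = 1" if "t \<in> {0..1}" for t i
    using orth that by (intro norm_row_orthogonal_matrix) (auto simp: orthogonal_group_def image_subset_iff)
  have entry: "\<gamma> t $ i $ i = axis i 1 \<bullet> \<gamma> t $ i" for t i
    by (simp add: inner_axis')
  have approx: "real (card S) * (arccos (- r) - arccos r) \<le> sqrt (real (card S)) * ?L"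
    if r: "0 < r" "r < 1" for r
  proof -
    let ?F = "\<lambda>t. \<Sum>i\<in>S. arccos (r * (\<gamma> t $ i $ i))"
    have "?F 1 - ?F 0 \<le> sqrt (real (card S)) * integral {0..1} (\<lambda>t. norm (vector_derivative \<gamma> (at t)))"
    proof (rule increment_le_curve_length[OF pieces])
      have "continuous_on {0..1} \<gamma>"
        using pieces by (simp add: C1_on_pieces_def)
      moreover have "-1 \<le> r * (\<gamma> t $ i $ i) \<and> r * (\<gamma> t $ i $ i) \<le> 1" if "t \<in> {0..1}" for t i
      proof -
        have "\<bar>\<gamma> t $ i $ i\<bar> \<le> 1"
          using component_le_norm_cart[of "\<gamma> t $ i" i] row[OF that] by simp
        then have "\<bar>r * (\<gamma> t $ i $ i)\<bar> \<le> 1"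
          using r by (simp add: abs_mult mult_le_one)
        then show ?thesis
          by linarith
      qed
      ultimately show "continuous_on {0..1} ?F"
        by (auto intro!: continuous_intros)
      fix t D
      assume t: "0 < t" "t < 1" and D: "(\<gamma> has_vector_derivative D) (at t)"
      have Di: "((\<lambda>s. \<gamma> s $ i) has_vector_derivative D $ i) (at t)" for i
        by (rule bounded_linear.has_vector_derivative[OF bounded_linear_vec_nth D])
      have tangent: "\<gamma> t $ i \<bullet> D $ i = 0" for i
      proof -
        have "((\<lambda>s. \<gamma> s $ i \<bullet> \<gamma> s $ i) has_vector_derivative
            (\<gamma> t $ i \<bullet> D $ i + D $ i \<bullet> \<gamma> t $ i)) (at t)"
          by (rule bounded_bilinear.has_vector_derivative[OF bounded_bilinear_inner Di Di])
        moreover have "((\<lambda>s. \<gamma> s $ i \<bullet> \<gamma> s $ i) has_vector_derivative 0) (at t)"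
          by (rule has_vector_derivative_transform_within_open[OF has_vector_derivative_const[of 1],
                where S = "{0<..<1}"])
            (use t row in \<open>auto simp: norm_eq_1\<close>)
        ultimately have "\<gamma> t $ i \<bullet> D $ i + D $ i \<bullet> \<gamma> t $ i = 0"
          by (rule vector_derivative_unique_at)
        then show ?thesis
          by (simp add: inner_commute)
      qed
      have "\<exists>F'. ((\<lambda>s. arccos (r * (\<gamma> s $ i $ i))) has_vector_derivative F') (at t) \<and> F' \<le> norm (D $ i)"
        for i
        unfolding entry
        using t r row tangent Di by (intro arccos_inner_derivative_bound) auto
      then obtain F' where F': "\<And>i. ((\<lambda>s. arccos (r * (\<gamma> s $ i $ i))) has_vector_derivative F' i) (at t)"
        "\<And>i. F' i \<le> norm (D $ i)"
        by metis
      show "\<exists>F'. (?F has_vector_derivative F') (at t) \<and> F' \<le> sqrt (real (card S)) * norm D"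
      proof (intro exI conjI)
        show "(?F has_vector_derivative (\<Sum>i\<in>S. F' i)) (at t)"
          by (intro has_vector_derivative_sum F')
        show "(\<Sum>i\<in>S. F' i) \<le> sqrt (real (card S)) * norm D"
          using sum_norm_rows_le[of D S] sum_mono[of S F', OF F'(2)] by linarith
      qed
    qed
    then show ?thesis
      using start stop by (simp add: curve_length_frobenius algebra_simps)
  qed
  \<comment> \<open>Letting \<open>r\<close> tend to 1 from below turns \<open>approx\<close> into
    the bound with the full angle \<open>arccos (- 1) - arccos 1 = pi\<close>.\<close>
  have "((\<lambda>r. real (card S) * (arccos (- r) - arccos r)) \<longlongrightarrow>
      real (card S) * (arccos (- 1) - arccos 1)) (at_left 1)"
  proof -
    have "continuous_on {-1..1} (\<lambda>r. real (card S) * (arccos (- r) - arccos r))"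
      by (auto intro!: continuous_intros)
    then have "((\<lambda>r. real (card S) * (arccos (- r) - arccos r)) \<longlongrightarrow>
      real (card S) * (arccos (- 1) - arccos 1)) (at 1 within {-1..1})"
      unfolding continuous_on_def by (rule bspec[where x = 1]) simp
    moreover have "at_left (1::real) = at 1 within {-1..1}"
      by (subst at_within_Icc_at_left) auto
    ultimately show ?thesis
      by simp
  qed
  moreover have "\<forall>\<^sub>F r in at_left 1. real (card S) * (arccos (- r) - arccos r) \<le> sqrt (real (card S)) * ?L"
    using approx by (intro eventually_at_leftI[of 0]) auto
  ultimately have "real (card S) * (arccos (- 1) - arccos 1) \<le> sqrt (real (card S)) * ?L"
    by (intro tendsto_upperbound) auto
  then have "sqrt (real (card S)) * (sqrt (real (card S)) * pi) \<le> sqrt (real (card S)) * ?L"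
    by (simp flip: mult.assoc)
  then show ?thesis
    using S by simp
qed

subsection \<open>Normal form of orthogonal transformations\<close>

text \<open>The angle can be kept in \<open>[0, pi]\<close> because replacing \<open>y\<close> by
  \<open>- y\<close> reverses its sign. The value \<open>pi\<close> covers two orthonormal
  eigenvectors for the eigenvalue -1.\<close>

definition rotates_plane :: "('a::real_inner \<Rightarrow> 'a) \<Rightarrow> 'a \<Rightarrow> 'a \<Rightarrow> real \<Rightarrow> bool" where
  "rotates_plane f x y \<theta> \<longleftrightarrow> 0 \<le> \<theta> \<and> \<theta> \<le> pi \<and> norm x = 1 \<and> norm y = 1 \<and> x \<bullet> y = 0 \<and>
     f x = cos \<theta> *\<^sub>R x + sin \<theta> *\<^sub>R y \<and> f y = cos \<theta> *\<^sub>R y - sin \<theta> *\<^sub>R x"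

text \<open>Only the values below \<open>k\<close> matter, so a family is extended by updating
  \<open>u\<close> and \<open>v\<close> at \<open>k\<close>.\<close>

definition orthonormal_pairs :: "nat \<Rightarrow> (nat \<Rightarrow> 'a::real_inner) \<Rightarrow> (nat \<Rightarrow> 'a) \<Rightarrow> bool" where
  "orthonormal_pairs k u v \<longleftrightarrow> (\<forall>i<k. \<forall>j<k. u i \<bullet> u j = (if i = j then 1 else 0) \<and>
     v i \<bullet> v j = (if i = j then 1 else 0) \<and> u i \<bullet> v j = 0)"

text \<open>The first-order condition for a minimum at \<open>t = 0\<close>. It is tested at
  \<open>t = - b / (\<bar>c\<bar> + 1)\<close>, where the quadratic term is too small to offset the
  negative linear term, whatever the sign of \<open>c\<close>.\<close>

lemma quadratic_nonneg_imp_linear_zero: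
  fixes b c :: real
  assumes "\<And>t. 0 \<le> t * b + t\<^sup>2 * c"
  shows "b = 0"
proof (rule ccontr)
  assume b: "b \<noteq> 0"
  define q where "q = b / (\<bar>c\<bar> + 1)"
  have bq: "b = q * (\<bar>c\<bar> + 1)" "q \<noteq> 0"
    using b by (simp_all add: q_def)
  have "0 \<le> (- q) * b + (- q)\<^sup>2 * c"
    by (rule assms)
  also have "\<dots> = q\<^sup>2 * (c - (\<bar>c\<bar> + 1))"
    by (simp add: bq(1) power2_eq_square algebra_simps)
  also have "\<dots> < 0"
    using bq by (intro mult_pos_neg) auto
  finally show False
    by simp
qed

text \<open>A minimiser of \<open>f x \<bullet> x\<close> on the unit sphere is an eigenvector of \<open>f + f\<^sup>T\<close>, so that
  \<open>span {x, f x}\<close> is invariant.\<close>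

lemma orthogonal_transformation_critical_vector:
  fixes f :: "'a::euclidean_space \<Rightarrow> 'a"
  assumes f: "orthogonal_transformation f" and S: "subspace S" "f ` S \<subseteq> S" "S \<noteq> {0}"
  obtains x where "x \<in> S" "norm x = 1" "f (f x) = (2 * (f x \<bullet> x)) *\<^sub>R f x - x"
    "\<And>z. z \<in> S \<Longrightarrow> (f x \<bullet> x) * (z \<bullet> z) \<le> f z \<bullet> z"
proof -
  have lin: "linear f" and iso: "\<And>v w. f v \<bullet> f w = v \<bullet> w"
    using f by (auto simp: orthogonal_transformation_def)
  let ?K = "sphere 0 1 \<inter> S"
  obtain y where "y \<in> S" "y \<noteq> 0"
    using S subspace_0 by blast
  then have "y /\<^sub>R norm y \<in> ?K"
    using S by (auto simp: subspace_scale)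
  moreover have "compact ?K"
    using S by (intro compact_Int_closed) (auto simp: closed_subspace)
  moreover have "continuous_on ?K (\<lambda>x. f x \<bullet> x)"
    by (intro continuous_intros linear_continuous_on) (simp add: lin linear_conv_bounded_linear[symmetric])
  ultimately obtain x where "x \<in> ?K" and min: "\<And>z. z \<in> ?K \<Longrightarrow> f x \<bullet> x \<le> f z \<bullet> z"
    using continuous_attains_inf[of ?K "\<lambda>x. f x \<bullet> x"] by (metis empty_iff)
  then have x: "x \<in> S" "norm x = 1"
    by auto
  define l where "l = f x \<bullet> x"
  have xx: "x \<bullet> x = 1"
    using x by (simp add: norm_eq_1)
  have ge: "l * (z \<bullet> z) \<le> f z \<bullet> z" if "z \<in> S" for z
  proof (cases "z = 0")
    case True
    then show ?thesis by simp
  next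
    case False
    have "z /\<^sub>R norm z \<in> ?K"
      using False that S by (auto simp: subspace_scale)
    from min[OF this] have "l \<le> (f z \<bullet> z) / (norm z)\<^sup>2"
      by (simp add: l_def linear_scale[OF lin] power2_eq_square field_simps)
    then show ?thesis
      using False by (simp add: pos_le_divide_eq power2_norm_eq_inner)
  qed
  \<comment> \<open>The form \<open>f z \<bullet> z - l * (z \<bullet> z)\<close> is nonnegative on
    \<open>S\<close> and vanishes at \<open>x\<close>, so its derivative at \<open>x\<close> in each
    direction \<open>w\<close> of \<open>S\<close> is zero.\<close>
  have crit: "f x \<bullet> w + f w \<bullet> x - 2 * l * (x \<bullet> w) = 0" if "w \<in> S" for w
  proof (rule quadratic_nonneg_imp_linear_zero)
    fix t :: real
    have "x + t *\<^sub>R w \<in> S"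
      using that x S by (simp add: subspace_add subspace_scale)
    from ge[OF this]
    show "0 \<le> t * (f x \<bullet> w + f w \<bullet> x - 2 * l * (x \<bullet> w)) + t\<^sup>2 * (f w \<bullet> w - l * (w \<bullet> w))"
      by (simp add: linear_add[OF lin] linear_scale[OF lin] inner_add_left inner_add_right xx
          l_def[symmetric] inner_commute[of w x] power2_eq_square algebra_simps)
  qed
  have fS: "f w \<in> S" if "w \<in> S" for w
    using that S by auto
  \<comment> \<open>By \<open>crit\<close>, the vector \<open>(f + f\<^sup>T) x - 2 l x\<close> is
    orthogonal to \<open>S\<close>. Its image under \<open>f\<close> is \<open>z\<close>, because
    \<open>f f\<^sup>T\<close> is the identity; this form avoids the adjoint.\<close>
  define z where "z = f (f x) - (2 * l) *\<^sub>R f x + x"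
  have zf: "z \<bullet> f w = 0" if "w \<in> S" for w
    using crit[OF that]
    by (simp add: z_def inner_add_left inner_diff_left iso inner_commute[of "f w" x])
  have "z \<bullet> f (f x) = 1 - 2 * l * l + x \<bullet> f (f x)"
    by (simp add: z_def inner_add_left inner_diff_left iso xx)
      (simp add: l_def inner_commute)
  moreover have "z \<bullet> x = f (f x) \<bullet> x - 2 * l * l + 1"
    by (simp add: z_def inner_add_left inner_diff_left xx l_def)
  ultimately have "z \<bullet> x = z \<bullet> f (f x)"
    by (simp add: inner_commute)
  then have "z \<bullet> x = 0"
    using zf fS x by simp
  have "z \<bullet> z = z \<bullet> f (f x) - (2 * l) * (z \<bullet> f x) + z \<bullet> x"
    by (subst (2) z_def) (simp add: inner_add_right inner_diff_right)
  then have "z = 0"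
    using zf fS x \<open>z \<bullet> x = 0\<close> by simp
  then have "f (f x) = (2 * l) *\<^sub>R f x - x"
    unfolding z_def by (simp add: algebra_simps add_eq_0_iff2)
  then show thesis
    using that x ge unfolding l_def by blast
qed

text \<open>For the minimiser \<open>x\<close>, the number \<open>l = f x \<bullet> x\<close> is the
  cosine of the largest angle by which \<open>f\<close> turns a vector of \<open>S\<close>. If
  \<open>l = 1\<close> then \<open>f\<close> turns nothing, and if \<open>l = -1\<close> then
  \<open>f x = - x\<close>. Otherwise \<open>x\<close> and the normalised part of \<open>f x\<close>
  orthogonal to \<open>x\<close> form a plane rotated by \<open>arccos l\<close>.\<close>

lemma orthogonal_transformation_trichotomy:
  fixes f :: "'a::euclidean_space \<Rightarrow> 'a"
  assumes f: "orthogonal_transformation f" and S: "subspace S" "f ` S \<subseteq> S"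
  shows "(\<forall>x\<in>S. f x = x) \<or> (\<exists>x\<in>S. norm x = 1 \<and> f x = - x) \<or>
    (\<exists>x\<in>S. \<exists>y\<in>S. \<exists>\<theta>. rotates_plane f x y \<theta>)"
proof (cases "S = {0}")
  case True
  then show ?thesis
    using f by (auto simp: orthogonal_transformation_def linear_0)
next
  case False
  have lin: "linear f" and iso: "\<And>v w. f v \<bullet> f w = v \<bullet> w" and nf: "\<And>v. norm (f v) = norm v"
    using f by (auto simp: orthogonal_transformation_def orthogonal_transformation_norm)
  obtain x where x: "x \<in> S" "norm x = 1" and ffx: "f (f x) = (2 * (f x \<bullet> x)) *\<^sub>R f x - x"
    and ge: "\<And>z. z \<in> S \<Longrightarrow> (f x \<bullet> x) * (z \<bullet> z) \<le> f z \<bullet> z"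
    using orthogonal_transformation_critical_vector[OF f S False] by metis
  define l where "l = f x \<bullet> x"
  have xx: "x \<bullet> x = 1"
    using x by (simp add: norm_eq_1)
  have "\<bar>l\<bar> \<le> 1"
    using Cauchy_Schwarz_ineq2[of "f x" x] x nf by (simp add: l_def)
  then consider "l = 1" | "l = -1" | "-1 < l" "l < 1"
    by linarith
  then show ?thesis
  proof cases
    case 1
    have "f z = z" if "z \<in> S" for z
    proof -
      have "(f z - z) \<bullet> (f z - z) = 2 * (z \<bullet> z) - 2 * (f z \<bullet> z)"
        by (simp add: inner_diff_left inner_diff_right iso inner_commute)
      also have "\<dots> \<le> 0"
        using ge[OF that] 1 by (simp add: l_def)
      finally have "(f z - z) \<bullet> (f z - z) = 0"
        using inner_ge_zero[of "f z - z"] by linarith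
      then show ?thesis
        by simp
    qed
    then show ?thesis
      by blast
  next
    case 2
    have "(f x + x) \<bullet> (f x + x) = 0"
      using 2 by (simp add: inner_add_left inner_add_right iso inner_commute xx l_def)
    then have "f x = - x"
      by (simp add: eq_neg_iff_add_eq_0)
    then show ?thesis
      using x by blast
  next
    case 3
    define s where "s = sqrt (1 - l\<^sup>2)"
    have s: "s > 0" and ss: "s * s = 1 - l * l"
      using 3 abs_square_less_1[of l] by (auto simp: s_def power2_eq_square)
    define y where "y = (1 / s) *\<^sub>R (f x - l *\<^sub>R x)"
    have "y \<in> S"
      using x S by (auto simp: y_def subspace_diff subspace_scale)
    have fx: "f x = l *\<^sub>R x + s *\<^sub>R y"
      using s by (simp add: y_def)
    have yy: "y \<bullet> y = 1"
    proof -
      have "(f x - l *\<^sub>R x) \<bullet> (f x - l *\<^sub>R x) = 1 - l * l"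
        by (simp add: inner_diff_left inner_diff_right iso inner_commute xx l_def[symmetric])
          (simp add: l_def inner_commute)
      then show ?thesis
        using s by (simp add: y_def ss[symmetric])
    qed
    have xy: "x \<bullet> y = 0"
      by (simp add: y_def inner_diff_right xx) (simp add: l_def inner_commute)
    have "f y = (1 / s) *\<^sub>R (f (f x) - l *\<^sub>R f x)"
      by (simp add: y_def linear_scale[OF lin] linear_diff[OF lin])
    also have "f (f x) - l *\<^sub>R f x = l *\<^sub>R f x - x"
      by (simp add: ffx l_def[symmetric] algebra_simps) (simp flip: scaleR_left.add)
    also have "\<dots> = (l * l - 1) *\<^sub>R x + (l * s) *\<^sub>R y"
      by (simp add: fx algebra_simps)
    also have "l * l - 1 = - (s * s)"
      by (simp add: ss)
    also have "(1 / s) *\<^sub>R (- (s * s) *\<^sub>R x + (l * s) *\<^sub>R y) = l *\<^sub>R y - s *\<^sub>R x"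
      using s by (simp add: algebra_simps)
    finally have fy: "f y = l *\<^sub>R y - s *\<^sub>R x" .
    have "rotates_plane f x y (arccos l)"
      using 3 x yy xy fx fy
      by (simp add: rotates_plane_def norm_eq_1 arccos_lbound arccos_ubound sin_arccos s_def)
    then show ?thesis
      using x \<open>y \<in> S\<close> by blast
  qed
qed

text \<open>Let \<open>w\<close> in \<open>S\<close> be a unit vector with \<open>f w = - w\<close>.
  A second such vector in the complement of \<open>w\<close> would form with \<open>w\<close> a
  plane rotated by \<open>pi\<close>, against \<open>max\<close>. By the trichotomy \<open>f\<close>
  then fixes that complement, so it acts on \<open>S\<close> as the reflection along
  \<open>w\<close>.\<close>

lemma orthogonal_transformation_normal_form_step:
  fixes f :: "'a::euclidean_space \<Rightarrow> 'a"
  assumes f: "orthogonal_transformation f" and S: "subspace S" "f ` S \<subseteq> S"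
    and max: "\<And>x y \<theta>. \<lbrakk>x \<in> S; y \<in> S\<rbrakk> \<Longrightarrow> \<not> rotates_plane f x y \<theta>"
  shows "(\<forall>x\<in>S. f x = x) \<or> (\<exists>w\<in>S. norm w = 1 \<and> (\<forall>x\<in>S. f x = x - (2 * (w \<bullet> x)) *\<^sub>R w))"
proof (rule disjCI)
  assume "\<not> (\<exists>w\<in>S. norm w = 1 \<and> (\<forall>x\<in>S. f x = x - (2 * (w \<bullet> x)) *\<^sub>R w))"
  then have not_refl: "\<And>w. \<lbrakk>w \<in> S; norm w = 1\<rbrakk> \<Longrightarrow> \<not> (\<forall>x\<in>S. f x = x - (2 * (w \<bullet> x)) *\<^sub>R w)"
    by blast
  have lin: "linear f" and iso: "\<And>v w. f v \<bullet> f w = v \<bullet> w"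
    using f by (auto simp: orthogonal_transformation_def)
  show "\<forall>x\<in>S. f x = x"
  proof (rule ccontr)
    assume "\<not> (\<forall>x\<in>S. f x = x)"
    then obtain w where w: "w \<in> S" "norm w = 1" "f w = - w"
      using orthogonal_transformation_trichotomy[OF f S] max by blast
    have ww: "w \<bullet> w = 1"
      using w by (simp add: norm_eq_1)
    let ?T = "S \<inter> {x. w \<bullet> x = 0}"
    have T: "subspace ?T"
      by (intro subspace_inter S subspace_hyperplane)
    have "f ` ?T \<subseteq> ?T"
    proof safe
      fix x assume "x \<in> S" "w \<bullet> x = 0"
      show "f x \<in> S"
        using \<open>x \<in> S\<close> S by blast
      show "w \<bullet> f x = 0"
        using iso[of w x] w \<open>w \<bullet> x = 0\<close> by simp
    qed
    from orthogonal_transformation_trichotomy[OF f T this] max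
    consider "\<forall>x\<in>?T. f x = x" | x where "x \<in> ?T" "norm x = 1" "f x = - x"
      by blast
    then show False
    proof cases
      case 1
      have "f x = x - (2 * (w \<bullet> x)) *\<^sub>R w" if "x \<in> S" for x
      proof -
        have "x - (w \<bullet> x) *\<^sub>R w \<in> ?T"
          using that w S ww by (simp add: subspace_diff subspace_scale inner_diff_right)
        then have "f (x - (w \<bullet> x) *\<^sub>R w) = x - (w \<bullet> x) *\<^sub>R w"
          using 1 by blast
        then have "f x + (w \<bullet> x) *\<^sub>R w = x - (w \<bullet> x) *\<^sub>R w"
          by (simp add: linear_diff[OF lin] linear_scale[OF lin] w)
        then have "f x = x - ((w \<bullet> x) *\<^sub>R w + (w \<bullet> x) *\<^sub>R w)"
          by (metis add_diff_cancel_right' diff_diff_eq)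
        then show ?thesis
          by (simp only: mult_2 scaleR_add_left)
      qed
      with not_refl w show False
        by blast
    next
      case 2
      then have "rotates_plane f w x pi"
        using w by (simp add: rotates_plane_def)
      with max 2 w show False
        by blast
    qed
  qed
qed

text \<open>The \<open>2 * k\<close> vectors are orthonormal, hence independent. This bounds the
  number of rotated planes that can be split off, and later the number of angles that enter the
  length.\<close>

lemma orthonormal_pairs_card:
  fixes u v :: "nat \<Rightarrow> 'a::euclidean_space"
  assumes "orthonormal_pairs k u v"
  shows "2 * k \<le> DIM('a)"
proof -
  have uu: "u i \<bullet> u j = (if i = j then 1 else 0)" and vv: "v i \<bullet> v j = (if i = j then 1 else 0)"
    and uv: "u i \<bullet> v j = 0" if "i < k" "j < k" for i j
    using assms that by (auto simp: orthonormal_pairs_def)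
  let ?U = "u ` {..<k}" and ?V = "v ` {..<k}"
  have "inj_on u {..<k}"
    by (rule inj_onI) (metis lessThan_iff uu zero_neq_one)
  moreover have "inj_on v {..<k}"
    by (rule inj_onI) (metis lessThan_iff vv zero_neq_one)
  moreover have "?U \<inter> ?V = {}"
    using uu uv by (fastforce simp: disjoint_iff)
  ultimately have card: "card (?U \<union> ?V) = 2 * k"
    by (simp add: card_Un_disjoint card_image)
  have "independent (?U \<union> ?V)"
  proof (rule pairwise_orthogonal_independent)
    show "pairwise orthogonal (?U \<union> ?V)"
      unfolding pairwise_def orthogonal_def using uu vv uv by (auto simp: inner_commute) 
    show "0 \<notin> ?U \<union> ?V"
      using uu vv by force
  qed
  from independent_card_le[OF this] show ?thesis
    by (simp add: card)
qed

text \<open>Choose as many orthonormal rotated planes as possible. Their common orthogonal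
  complement is invariant and contains no further rotated plane, so the preceding step describes
  \<open>f\<close> on it.\<close>

lemma orthogonal_transformation_normal_form:
  fixes f :: "'a::euclidean_space \<Rightarrow> 'a"
  assumes f: "orthogonal_transformation f"
  obtains k u v \<theta> where "orthonormal_pairs k u v" "\<forall>i<k. rotates_plane f (u i) (v i) (\<theta> i)"
    "let S = {x. \<forall>i<k. u i \<bullet> x = 0 \<and> v i \<bullet> x = 0} in
      (\<forall>x\<in>S. f x = x) \<or> (\<exists>w\<in>S. norm w = 1 \<and> (\<forall>x\<in>S. f x = x - (2 * (w \<bullet> x)) *\<^sub>R w))"
proof -
  have lin: "linear f" and iso: "\<And>v w. f v \<bullet> f w = v \<bullet> w"
    using f by (auto simp: orthogonal_transformation_def)
  define P where "P k \<longleftrightarrow> (\<exists>u v \<theta>. orthonormal_pairs k u v \<and> (\<forall>i<k. rotates_plane f (u i) (v i) (\<theta> i)))" for k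
  have "P 0"
    by (simp add: P_def orthonormal_pairs_def)
  moreover have "\<forall>k. P k \<longrightarrow> k \<le> DIM('a)"
    using orthonormal_pairs_card unfolding P_def by fastforce
  ultimately obtain k where "P k" and kmax: "\<And>j. P j \<Longrightarrow> j \<le> k"
    using Nat.ex_has_greatest_nat[of P 0 "DIM('a)"] by blast
  then obtain u v \<theta> where pairs: "orthonormal_pairs k u v"
    and rot: "\<And>i. i < k \<Longrightarrow> rotates_plane f (u i) (v i) (\<theta> i)"
    unfolding P_def by blast
  let ?S = "{x. \<forall>i<k. u i \<bullet> x = 0 \<and> v i \<bullet> x = 0}"
  have "subspace ?S"
    by (auto simp: subspace_def inner_add_right)
  moreover have "f ` ?S \<subseteq> ?S"
  proof clarify
    fix x i
    assume x: "\<forall>i<k. u i \<bullet> x = 0 \<and> v i \<bullet> x = 0" and i: "i < k"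
    let ?c = "cos (\<theta> i)" and ?s = "sin (\<theta> i)"
    have fu: "f (u i) = ?c *\<^sub>R u i + ?s *\<^sub>R v i" and fv: "f (v i) = ?c *\<^sub>R v i - ?s *\<^sub>R u i"
      using rot[OF i] by (auto simp: rotates_plane_def)
    \<comment> \<open>Pairing \<open>f x\<close> with \<open>f (u i)\<close> and
      \<open>f (v i)\<close> gives a linear system for \<open>u i \<bullet> f x\<close> and
      \<open>v i \<bullet> f x\<close> whose determinant is
      \<open>?c\<^sup>2 + ?s\<^sup>2 = 1\<close>, so both vanish.\<close>
    have e1: "?c * (u i \<bullet> f x) + ?s * (v i \<bullet> f x) = 0"
      using iso[of "u i" x] x i by (simp add: fu inner_add_left)
    have e2: "?c * (v i \<bullet> f x) - ?s * (u i \<bullet> f x) = 0"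
      using iso[of "v i" x] x i by (simp add: fv inner_diff_left)
    have "(?c\<^sup>2 + ?s\<^sup>2) * (u i \<bullet> f x) = 0" "(?c\<^sup>2 + ?s\<^sup>2) * (v i \<bullet> f x) = 0"
      using e1 e2 by algebra+
    then show "u i \<bullet> f x = 0 \<and> v i \<bullet> f x = 0"
      by simp
  qed
  moreover have "\<not> rotates_plane f x y \<phi>" if "x \<in> ?S" "y \<in> ?S" for x y \<phi>
  proof
    assume xy: "rotates_plane f x y \<phi>"
    have "orthonormal_pairs (Suc k) (u(k := x)) (v(k := y))"
      using pairs that xy
      by (auto simp: orthonormal_pairs_def less_Suc_eq rotates_plane_def norm_eq_1 inner_commute)
    moreover have "\<forall>i<Suc k. rotates_plane f ((u(k := x)) i) ((v(k := y)) i) ((\<theta>(k := \<phi>)) i)"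
      using rot xy by (auto simp: less_Suc_eq)
    ultimately have "P (Suc k)"
      unfolding P_def by blast
    then show False
      using kmax by fastforce
  qed
  ultimately have "let S = ?S in
      (\<forall>x\<in>S. f x = x) \<or> (\<exists>w\<in>S. norm w = 1 \<and> (\<forall>x\<in>S. f x = x - (2 * (w \<bullet> x)) *\<^sub>R w))"
    unfolding Let_def by (rule orthogonal_transformation_normal_form_step[OF f])
  moreover have "\<forall>i<k. rotates_plane f (u i) (v i) (\<theta> i)"
    using rot by blast
  ultimately show thesis
    using pairs by (intro that)
qed

subsection \<open>Rotating in orthogonal planes\<close>

definition outer_product :: "real^'m \<Rightarrow> real^'n \<Rightarrow> real^'n^'m" where
  "outer_product x y = (\<chi> i j. x $ i * y $ j)"

lemma outer_product_mult_vec: "outer_product x y *v z = (y \<bullet> z) *\<^sub>R x"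
  by (simp add: vec_eq_iff outer_product_def matrix_vector_mult_def inner_vec_def
      sum_distrib_left sum_distrib_right mult_ac)

lemma inner_outer_product: "outer_product x y \<bullet> outer_product x' y' = (x \<bullet> x') * (y \<bullet> y')"
  by (simp add: outer_product_def inner_vec_def sum_product mult_ac) (rule sum.swap)

lemma matrix_eqI_mult_vec:
  fixes A B :: "real^'n^'m"
  assumes "\<And>x. A *v x = B *v x"
  shows "A = B"
  using assms by (simp add: matrix_eq)

lemma sum_matrix_vector_mult: "(\<Sum>i\<in>I. A i) *v x = (\<Sum>i\<in>I. A i *v x)" for A :: "'i \<Rightarrow> real^'n^'m"
  by (induction I rule: infinite_finite_induct) (simp_all add: matrix_vector_mult_add_rdistrib)

lemma orthogonal_matrix_iff_orthogonal_transformation: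
  fixes A :: "real^'n^'n"
  shows "orthogonal_matrix A \<longleftrightarrow> orthogonal_transformation ((*v) A)"
  by (simp add: orthogonal_transformation_matrix)

text \<open>Written as the identity plus a correction in each plane, so that no basis of the
  orthogonal complement has to be chosen and the dependence on the angles is explicit.\<close>

definition plane_rotations ::
  "nat \<Rightarrow> (nat \<Rightarrow> real^'n) \<Rightarrow> (nat \<Rightarrow> real^'n) \<Rightarrow> (nat \<Rightarrow> real) \<Rightarrow> real^'n^'n" where
  "plane_rotations k u v \<phi> = mat 1 + (\<Sum>i<k.
     (cos (\<phi> i) - 1) *\<^sub>R (outer_product (u i) (u i) + outer_product (v i) (v i)) +
     sin (\<phi> i) *\<^sub>R (outer_product (v i) (u i) - outer_product (u i) (v i)))"

lemma plane_rotations_zero: "plane_rotations k u v (\<lambda>_. 0) = mat 1"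
  by (simp add: plane_rotations_def)

lemma plane_rotations_mult_vec:
  "plane_rotations k u v \<phi> *v x = x + (\<Sum>i<k.
     (cos (\<phi> i) - 1) *\<^sub>R ((u i \<bullet> x) *\<^sub>R u i + (v i \<bullet> x) *\<^sub>R v i) +
     sin (\<phi> i) *\<^sub>R ((u i \<bullet> x) *\<^sub>R v i - (v i \<bullet> x) *\<^sub>R u i))"
  by (simp add: plane_rotations_def matrix_vector_mult_add_rdistrib sum_matrix_vector_mult
      scaleR_matrix_vector_assoc[symmetric] outer_product_mult_vec matrix_vector_mult_diff_rdistrib)

lemma orthonormal_pairsD:
  assumes "orthonormal_pairs k u v" "i < k" "j < k"
  shows "u i \<bullet> u j = (if i = j then 1 else 0)" "v i \<bullet> v j = (if i = j then 1 else 0)"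
    "u i \<bullet> v j = 0" "v i \<bullet> u j = 0"
  using assms by (auto simp: orthonormal_pairs_def inner_commute)

text \<open>The corrections \<open>w i\<close> to \<open>x\<close> are pairwise orthogonal and
  satisfy \<open>w i \<bullet> w i = - 2 * (x \<bullet> w i)\<close>. Their sum satisfies the same
  equation, which says exactly that adding it to \<open>x\<close> preserves the norm.\<close>

lemma orthogonal_plane_rotations:
  assumes "orthonormal_pairs k u v"
  shows "orthogonal_matrix (plane_rotations k u v \<phi>)"
proof -
  note pairs = orthonormal_pairsD[OF assms]
  have "norm (plane_rotations k u v \<phi> *v x) = norm x" for x
  proof -
    define w where "w i = (cos (\<phi> i) - 1) *\<^sub>R ((u i \<bullet> x) *\<^sub>R u i + (v i \<bullet> x) *\<^sub>R v i) +
     sin (\<phi> i) *\<^sub>R ((u i \<bullet> x) *\<^sub>R v i - (v i \<bullet> x) *\<^sub>R u i)" for i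
    have Rx: "plane_rotations k u v \<phi> *v x = x + (\<Sum>i<k. w i)"
      by (simp add: plane_rotations_mult_vec w_def)
    have orth: "w i \<bullet> w j = 0" if "i < k" "j < k" "i \<noteq> j" for i j
      using that
      by (simp add: w_def pairs inner_add_left inner_add_right inner_diff_left inner_diff_right)
    have ww: "w i \<bullet> w i = - 2 * (x \<bullet> w i)" if "i < k" for i
    proof -
      let ?c = "cos (\<phi> i)" and ?s = "sin (\<phi> i)" and ?q = "(u i \<bullet> x)\<^sup>2 + (v i \<bullet> x)\<^sup>2"
      have "x \<bullet> w i = (?c - 1) * ?q"
        by (simp add: w_def inner_add_right inner_diff_right inner_commute[of x] power2_eq_square)
      moreover have "(p *\<^sub>R (a *\<^sub>R u i + b *\<^sub>R v i) + q *\<^sub>R (a *\<^sub>R v i - b *\<^sub>R u i)) \<bullet>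
          (p *\<^sub>R (a *\<^sub>R u i + b *\<^sub>R v i) + q *\<^sub>R (a *\<^sub>R v i - b *\<^sub>R u i)) =
          (p\<^sup>2 + q\<^sup>2) * (a\<^sup>2 + b\<^sup>2)" for p q a b
        using that
        by (simp add: pairs inner_add_left inner_add_right inner_diff_left inner_diff_right)
          (simp add: power2_eq_square algebra_simps)
      then have "w i \<bullet> w i = ((?c - 1)\<^sup>2 + ?s\<^sup>2) * ?q"
        unfolding w_def .
      moreover have "(?c - 1)\<^sup>2 + ?s\<^sup>2 = - 2 * (?c - 1)"
        using sin_cos_squared_add[of "\<phi> i"] by (simp add: power2_eq_square algebra_simps)
      ultimately show ?thesis
        by (simp only: mult.assoc)
    qed
    have "(norm (\<Sum>i<k. w i))\<^sup>2 = (\<Sum>i<k. (norm (w i))\<^sup>2)"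
      by (rule norm_sum_Pythagorean) (auto simp: pairwise_def orthogonal_def orth)
    then have "(\<Sum>i<k. w i) \<bullet> (\<Sum>i<k. w i) = - 2 * (x \<bullet> (\<Sum>i<k. w i))"
      by (simp add: power2_norm_eq_inner ww inner_sum_right sum_distrib_left)
    then show ?thesis
      unfolding Rx norm_eq by (simp add: inner_add_left inner_add_right inner_commute)
  qed
  then show ?thesis
    by (simp add: orthogonal_matrix_iff_orthogonal_transformation orthogonal_transformation)
qed

lemma plane_rotations_fix:
  assumes "\<And>i. i < k \<Longrightarrow> u i \<bullet> x = 0 \<and> v i \<bullet> x = 0"
  shows "plane_rotations k u v \<phi> *v x = x"
  using assms by (simp add: plane_rotations_mult_vec)

lemma plane_rotations_pair:
  assumes "orthonormal_pairs k u v" "i < k"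
  shows "plane_rotations k u v \<phi> *v u i = cos (\<phi> i) *\<^sub>R u i + sin (\<phi> i) *\<^sub>R v i"
    and "plane_rotations k u v \<phi> *v v i = cos (\<phi> i) *\<^sub>R v i - sin (\<phi> i) *\<^sub>R u i"
proof -
  note pairs = orthonormal_pairsD[OF assms(1) _ assms(2)]
  have "plane_rotations k u v \<phi> *v u i =
    u i + (\<Sum>j<k. if j = i then (cos (\<phi> i) - 1) *\<^sub>R u i + sin (\<phi> i) *\<^sub>R v i else 0)"
    unfolding plane_rotations_mult_vec by (intro arg_cong2[of _ _ _ _ "(+)"] sum.cong) (auto simp: pairs)
  then show "plane_rotations k u v \<phi> *v u i = cos (\<phi> i) *\<^sub>R u i + sin (\<phi> i) *\<^sub>R v i"
    using assms(2) by (simp add: algebra_simps)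
  have "plane_rotations k u v \<phi> *v v i =
    v i + (\<Sum>j<k. if j = i then (cos (\<phi> i) - 1) *\<^sub>R v i - sin (\<phi> i) *\<^sub>R u i else 0)"
    unfolding plane_rotations_mult_vec by (intro arg_cong2[of _ _ _ _ "(+)"] sum.cong) (auto simp: pairs)
  then show "plane_rotations k u v \<phi> *v v i = cos (\<phi> i) *\<^sub>R v i - sin (\<phi> i) *\<^sub>R u i"
    using assms(2) by (simp add: algebra_simps)
qed

lemma plane_rotations_has_vector_derivative:
  "((\<lambda>t. plane_rotations k u v (\<lambda>i. t * \<theta> i)) has_vector_derivative (\<Sum>i<k. \<theta> i *\<^sub>R
     (- sin (t * \<theta> i) *\<^sub>R (outer_product (u i) (u i) + outer_product (v i) (v i)) +
      cos (t * \<theta> i) *\<^sub>R (outer_product (v i) (u i) - outer_product (u i) (v i))))) (at t)"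
proof -
  have "((\<lambda>t. (cos (t * a) - 1) *\<^sub>R P + sin (t * a) *\<^sub>R Q) has_vector_derivative
      a *\<^sub>R (- sin (t * a) *\<^sub>R P + cos (t * a) *\<^sub>R Q)) (at t)" for a and P Q :: "real^'n^'n"
  proof -
    have "((\<lambda>t. cos (t * a) - 1) has_real_derivative - sin (t * a) * a) (at t)"
      "((\<lambda>t. sin (t * a)) has_real_derivative cos (t * a) * a) (at t)"
      by (auto intro!: derivative_eq_intros)
    from has_vector_derivative_add[OF this[THEN has_vector_derivative_scaleR, OF has_vector_derivative_const]]
    show ?thesis
      by (simp add: scaleR_diff_right mult.commute[of a])
  qed
  from has_vector_derivative_add[OF has_vector_derivative_const has_vector_derivative_sum[OF this]]
  show ?thesis
    unfolding plane_rotations_def by simp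
qed

text \<open>Different planes give orthogonal summands. Within one plane the symmetric and the skew
  matrix are orthogonal, each of squared norm 2, so by \<open>sin\<^sup>2 + cos\<^sup>2 = 1\<close>
  the speed does not depend on \<open>t\<close>.\<close>

lemma norm_plane_rotations_velocity:
  assumes "orthonormal_pairs k u v"
  shows "norm (\<Sum>i<k. \<theta> i *\<^sub>R
     (- sin (t * \<theta> i) *\<^sub>R (outer_product (u i) (u i) + outer_product (v i) (v i)) +
      cos (t * \<theta> i) *\<^sub>R (outer_product (v i) (u i) - outer_product (u i) (v i)))) =
    sqrt (\<Sum>i<k. 2 * (\<theta> i)\<^sup>2)"
proof -
  define B where "B i = \<theta> i *\<^sub>R
     (- sin (t * \<theta> i) *\<^sub>R (outer_product (u i) (u i) + outer_product (v i) (v i)) +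
      cos (t * \<theta> i) *\<^sub>R (outer_product (v i) (u i) - outer_product (u i) (v i)))" for i
  note pairs = orthonormal_pairsD[OF assms]
  have orth: "B i \<bullet> B j = 0" if "i < k" "j < k" "i \<noteq> j" for i j
    using that by (simp add: B_def pairs inner_outer_product inner_add_left inner_add_right
        inner_diff_left inner_diff_right)
  have "B i \<bullet> B i = 2 * (\<theta> i)\<^sup>2" if "i < k" for i
  proof -
    have "(a *\<^sub>R (p *\<^sub>R (outer_product (u i) (u i) + outer_product (v i) (v i)) +
          q *\<^sub>R (outer_product (v i) (u i) - outer_product (u i) (v i)))) \<bullet>
        (a *\<^sub>R (p *\<^sub>R (outer_product (u i) (u i) + outer_product (v i) (v i)) +
          q *\<^sub>R (outer_product (v i) (u i) - outer_product (u i) (v i)))) =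
        a\<^sup>2 * (2 * (p\<^sup>2 + q\<^sup>2))" for a p q
      using that by (simp add: pairs inner_outer_product inner_add_left inner_add_right
          inner_diff_left inner_diff_right) (simp add: power2_eq_square algebra_simps)
    then have "B i \<bullet> B i = (\<theta> i)\<^sup>2 * (2 * ((- sin (t * \<theta> i))\<^sup>2 + (cos (t * \<theta> i))\<^sup>2))"
      unfolding B_def .
    then show ?thesis
      by simp
  qed
  moreover have "(norm (\<Sum>i<k. B i))\<^sup>2 = (\<Sum>i<k. (norm (B i))\<^sup>2)"
    by (rule norm_sum_Pythagorean) (auto simp: pairwise_def orthogonal_def orth)
  ultimately have "(norm (\<Sum>i<k. B i))\<^sup>2 = (\<Sum>i<k. 2 * (\<theta> i)\<^sup>2)"
    by (simp add: power2_norm_eq_inner)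
  then have "norm (\<Sum>i<k. B i) = sqrt (\<Sum>i<k. 2 * (\<theta> i)\<^sup>2)"
    by (metis norm_ge_zero real_sqrt_unique)
  then show ?thesis
    unfolding B_def .
qed

section \<open>Determinants and the special orthogonal case\<close>

lemma continuous_on_det:
  fixes f :: "'a::topological_space \<Rightarrow> real^'n^'n"
  assumes "continuous_on T f"
  shows "continuous_on T (\<lambda>x. det (f x))"
  unfolding det_def by (intro continuous_intros assms)

text \<open>The determinant is continuous and takes only the values 1 and -1 here; a nonempty
  connected finite image is a singleton.\<close>

lemma det_eq_on_connected:
  fixes T :: "(real^'n^'n) set"
  assumes T: "connected T" "T \<subseteq> orthogonal_group" and AB: "A \<in> T" "B \<in> T"
  shows "det A = det B"
proof -
  have "connected (det ` T)"
    by (intro connected_continuous_image continuous_on_det T continuous_on_id)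
  moreover have "det ` T \<subseteq> {1, -1}"
    using T det_orthogonal_matrix by (fastforce simp: orthogonal_group_def)
  then have "finite (det ` T)"
    using finite_subset by blast
  ultimately obtain d where "det ` T = {d}"
    using connected_finite_iff_sing[of "det ` T"] AB by auto
  with AB show ?thesis
    by (metis imageI singletonD)
qed

text \<open>Scaling all angles by \<open>t\<close> joins the identity to the given matrix inside the
  orthogonal group, where the determinant is constant along the path.\<close>

lemma det_plane_rotations:
  assumes "orthonormal_pairs k u v"
  shows "det (plane_rotations k u v \<phi>) = 1"
proof -
  let ?g = "\<lambda>t. plane_rotations k u v (\<lambda>i. t * \<phi> i)"
  have "continuous_on {0..1} ?g"
    by (intro continuous_at_imp_continuous_on ballI)
      (rule has_vector_derivative_continuous[OF plane_rotations_has_vector_derivative])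
  then have "connected (?g ` {0..1})"
    by (rule connected_continuous_image) simp
  moreover have "?g ` {0..1} \<subseteq> orthogonal_group"
    by (auto simp: orthogonal_group_def orthogonal_plane_rotations assms)
  moreover have "?g 0 \<in> ?g ` {0..1}" "?g 1 \<in> ?g ` {0..1}"
    by (rule imageI, simp)+
  ultimately have "det (?g 0) = det (?g 1)"
    by (rule det_eq_on_connected)
  then show ?thesis
    by (simp add: plane_rotations_zero)
qed

lemma matrix_outer_product_transpose:
  fixes Q :: "real^'n^'n"
  shows "Q ** outer_product a b ** transpose Q = outer_product (Q *v a) (Q *v b)"
proof (rule matrix_eqI_mult_vec)
  fix x
  have "b \<bullet> (x v* Q) = (Q *v b) \<bullet> x"
    by (metis dot_lmul_matrix inner_commute)
  then show "Q ** outer_product a b ** transpose Q *v x = outer_product (Q *v a) (Q *v b) *v x"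
    by (simp add: outer_product_mult_vec matrix_vector_mult_scaleR flip: matrix_vector_mul_assoc)
qed

text \<open>An orthogonal \<open>Q\<close> that takes an arbitrarily chosen basis vector to
  \<open>w\<close> conjugates the reflection to a diagonal matrix with a single entry -1.\<close>

lemma det_reflection:
  fixes w :: "real^'n"
  assumes "norm w = 1"
  shows "det (mat 1 - 2 *\<^sub>R outer_product w w) = -1"
proof -
  define k :: 'n where "k = undefined"
  obtain Q where Q: "orthogonal_matrix Q" "Q *v axis k 1 = w"
    using orthogonal_matrix_exists_basis[OF assms] .
  define D :: "real^'n^'n" where "D = mat 1 - 2 *\<^sub>R outer_product (axis k 1) (axis k 1)"
  have "Q ** D ** transpose Q = Q ** transpose Q - 2 *\<^sub>R (Q ** outer_product (axis k 1) (axis k 1) ** transpose Q)"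
    by (rule matrix_eqI_mult_vec)
      (simp add: D_def scaleR_matrix_vector_assoc[symmetric] matrix_vector_mult_diff_rdistrib matrix_vector_mult_diff_distrib
        matrix_vector_mult_scaleR flip: matrix_vector_mul_assoc)
  also have "\<dots> = mat 1 - 2 *\<^sub>R outer_product w w"
    using Q by (simp add: matrix_outer_product_transpose orthogonal_matrix_def)
  finally have "det (mat 1 - 2 *\<^sub>R outer_product w w) = det Q * det D * det Q"
    by (metis det_mul det_transpose)
  also have "\<dots> = det D"
    using det_orthogonal_matrix[OF Q(1)] by auto
  also have "\<dots> = (\<Prod>i\<in>UNIV. D $ i $ i)"
    by (rule det_diagonal) (auto simp: D_def outer_product_def mat_def axis_def)
  also have "\<dots> = (\<Prod>i\<in>UNIV. if i = k then - 1 else 1)"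
    by (rule prod.cong) (simp_all add: D_def outer_product_def mat_def axis_def)
  also have "\<dots> = -1"
    by simp
  finally show ?thesis .
qed

text \<open>The normal form leaves the identity or a reflection on the complement of the planes. The
  reflection is ruled out because it would make the determinant -1.\<close>

lemma special_orthogonal_eq_plane_rotations:
  fixes A :: "real^'n^'n"
  assumes A: "orthogonal_matrix A" "det A = 1"
  obtains k u v \<theta> where "orthonormal_pairs k u v" "\<forall>i<k. 0 \<le> \<theta> i \<and> \<theta> i \<le> pi"
    "A = plane_rotations k u v \<theta>"
proof -
  have "orthogonal_transformation ((*v) A)"
    using A by (simp add: orthogonal_matrix_iff_orthogonal_transformation)
  then obtain k u v \<theta> where pairs: "orthonormal_pairs k u v"
    and rot: "\<forall>i<k. rotates_plane ((*v) A) (u i) (v i) (\<theta> i)"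
    and compl: "let S = {x. \<forall>i<k. u i \<bullet> x = 0 \<and> v i \<bullet> x = 0} in
      (\<forall>x\<in>S. A *v x = x) \<or> (\<exists>w\<in>S. norm w = 1 \<and> (\<forall>x\<in>S. A *v x = x - (2 * (w \<bullet> x)) *\<^sub>R w))"
    by (rule orthogonal_transformation_normal_form)
  define S where "S = {x. \<forall>i<k. u i \<bullet> x = 0 \<and> v i \<bullet> x = 0}"
  let ?R = "plane_rotations k u v \<theta>"
  \<comment> \<open>The orthogonal projection onto the sum of the rotated planes. \<open>A\<close>
    and \<open>?R\<close> agree on its range, so only their values at \<open>x - p x\<close> in
    \<open>S\<close> remain to be compared.\<close>
  define p where "p x = (\<Sum>i<k. (u i \<bullet> x) *\<^sub>R u i + (v i \<bullet> x) *\<^sub>R v i)" for x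
  have AR: "A *v p x = ?R *v p x" for x
    unfolding p_def linear_sum[OF matrix_vector_mul_linear]
    using rot plane_rotations_pair[OF pairs]
    by (intro sum.cong) (auto simp: rotates_plane_def matrix_vector_right_distrib matrix_vector_mult_scaleR)
  have S: "x - p x \<in> S" for x
  proof -
    have "u j \<bullet> p x = u j \<bullet> x" "v j \<bullet> p x = v j \<bullet> x" if "j < k" for j
      using that by (simp_all add: p_def inner_sum_right inner_add_right
          orthonormal_pairsD[OF pairs] if_distrib[of "(*) _"] cong: if_cong)
    then show ?thesis
      by (simp add: S_def inner_diff_right)
  qed
  have R_fix: "?R *v x = x" if "x \<in> S" for x
    using that by (intro plane_rotations_fix) (simp add: S_def)
  have split: "M *v x = M *v p x + M *v (x - p x)" for M :: "real^'n^'n" and x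
    by (simp flip: matrix_vector_right_distrib)
  from compl consider "\<forall>x\<in>S. A *v x = x"
    | w where "w \<in> S" "norm w = 1" "\<And>x. x \<in> S \<Longrightarrow> A *v x = x - (2 * (w \<bullet> x)) *\<^sub>R w"
    by (auto simp: S_def Let_def)
  then have "A = ?R"
  proof cases
    case 1
    show ?thesis
    proof (rule matrix_eqI_mult_vec)
      show "A *v x = ?R *v x" for x
        using split[of A x] split[of ?R x] AR 1 S R_fix by metis
    qed
  next
    case 2
    have "A = ?R ** (mat 1 - 2 *\<^sub>R outer_product w w)"
    proof (rule matrix_eqI_mult_vec)
      fix x
      have "w \<bullet> p x = 0"
        using 2(1) by (simp add: p_def S_def inner_sum_right inner_add_right inner_commute[of w])
      then have "A *v x = ?R *v x - (2 * (w \<bullet> x)) *\<^sub>R w"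
        using split[of A x] split[of ?R x] AR[of x] 2(3)[OF S[of x]] R_fix[OF S[of x]]
        by (simp add: inner_diff_right)
      also have "\<dots> = ?R *v (x - (2 * (w \<bullet> x)) *\<^sub>R w)"
        using R_fix[OF 2(1)] by (simp add: matrix_vector_mult_diff_distrib matrix_vector_mult_scaleR)
      also have "x - (2 * (w \<bullet> x)) *\<^sub>R w = (mat 1 - 2 *\<^sub>R outer_product w w) *v x"
        by (simp add: matrix_vector_mult_diff_rdistrib scaleR_matrix_vector_assoc[symmetric] outer_product_mult_vec)
      finally show "A *v x = ?R ** (mat 1 - 2 *\<^sub>R outer_product w w) *v x"
        by (simp add: matrix_vector_mul_assoc)
    qed
    then have "det A = -1"
      using det_reflection[OF 2(2)] det_plane_rotations[OF pairs, of \<theta>] by (simp add: det_mul)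
    with A show ?thesis
      by simp
  qed
  moreover have "\<forall>i<k. 0 \<le> \<theta> i \<and> \<theta> i \<le> pi"
    using rot by (simp add: rotates_plane_def)
  ultimately show thesis
    using pairs that by blast
qed

section \<open>Short curves in the orthogonal group\<close>

lemma norm_orthogonal_matrix_mult:
  fixes P V :: "real^'n^'n"
  assumes "orthogonal_matrix P"
  shows "norm (P ** V) = norm V"
proof -
  have "frobenius_metric (P ** V) (P ** V) = trace (transpose V ** (transpose P ** P) ** V)"
    by (simp add: frobenius_metric_def matrix_transpose_mul matrix_mul_assoc)
  also have "\<dots> = frobenius_metric V V"
    using assms by (simp add: frobenius_metric_def orthogonal_matrix_def)
  finally show ?thesis
    by (simp add: frobenius_metric_eq_inner norm_eq)
qed

lemma bounded_linear_matrix_mult_left: "bounded_linear (\<lambda>X. P ** X)" for P :: "real^'n^'n"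
  unfolding linear_conv_bounded_linear[symmetric]
  by (rule linearI)
    (simp_all add: vec_eq_iff matrix_matrix_mult_def sum.distrib sum_distrib_left algebra_simps)

text \<open>Left multiplication by \<open>P\<close> preserves the norm, so it suffices to go from
  the identity to \<open>transpose P ** Q\<close>, which has determinant 1, by scaling its rotation
  angles. There are at most \<open>CARD('n) div 2\<close> angles, each at most \<open>pi\<close>.
  Continuity is recorded because it places the end points in one component.\<close>

lemma orthogonal_group_short_curve:
  fixes P Q :: "real^'n^'n"
  assumes PQ: "P \<in> orthogonal_group" "Q \<in> orthogonal_group" "det P = det Q"
  obtains \<gamma> where "piecewise_C1_curve \<gamma>" "continuous_on {0..1} \<gamma>" "\<gamma> ` {0..1} \<subseteq> orthogonal_group"
    "\<gamma> 0 = P" "\<gamma> 1 = Q" "curve_length frobenius_metric \<gamma> \<le> sqrt (real (2 * (CARD('n) div 2))) * pi"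
proof -
  have P: "orthogonal_matrix P" and Q: "orthogonal_matrix Q"
    using PQ by (auto simp: orthogonal_group_def)
  have "orthogonal_matrix (transpose P ** Q)"
    using P Q by (simp add: orthogonal_matrix_mul)
  moreover have "det (transpose P ** Q) = 1"
    using PQ(3) det_orthogonal_matrix[OF P] by (auto simp: det_mul)
  ultimately obtain k u v \<theta> where pairs: "orthonormal_pairs k u v"
    and \<theta>: "\<forall>i<k. 0 \<le> \<theta> i \<and> \<theta> i \<le> pi" and R: "transpose P ** Q = plane_rotations k u v \<theta>"
    by (rule special_orthogonal_eq_plane_rotations)
  define \<gamma> where "\<gamma> t = P ** plane_rotations k u v (\<lambda>i. t * \<theta> i)" for t
  define V where "V t = (\<Sum>i<k. \<theta> i *\<^sub>R
     (- sin (t * \<theta> i) *\<^sub>R (outer_product (u i) (u i) + outer_product (v i) (v i)) +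
      cos (t * \<theta> i) *\<^sub>R (outer_product (v i) (u i) - outer_product (u i) (v i))))" for t
  have deriv: "(\<gamma> has_vector_derivative P ** V t) (at t)" for t
    unfolding \<gamma>_def V_def
    by (rule bounded_linear.has_vector_derivative[OF bounded_linear_matrix_mult_left
          plane_rotations_has_vector_derivative])
  have "continuous_on {0..1} (\<lambda>t. P ** V t)"
    by (rule bounded_linear.continuous_on[OF bounded_linear_matrix_mult_left])
      (auto simp: V_def intro!: continuous_intros)
  then have C1: "piecewise_C1_curve \<gamma>"
    unfolding piecewise_C1_curve_def
    \<comment> \<open>A single piece suffices: the partition \<open>real\<close> has the points 0
      and 1.\<close>
    by (intro exI[of _ 1] exI[of _ real])
      (auto intro!: exI[of _ "\<lambda>t. P ** V t"] has_vector_derivative_at_within deriv)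
  have cont: "continuous_on {0..1} \<gamma>"
    by (intro continuous_at_imp_continuous_on ballI) (rule has_vector_derivative_continuous[OF deriv])
  have sub: "\<gamma> ` {0..1} \<subseteq> orthogonal_group"
    using P orthogonal_plane_rotations[OF pairs]
    by (auto simp: \<gamma>_def orthogonal_group_def intro!: orthogonal_matrix_mul)
  have ends: "\<gamma> 0 = P" "\<gamma> 1 = Q"
    using P by (simp_all add: \<gamma>_def plane_rotations_zero R[symmetric] matrix_mul_assoc orthogonal_matrix_def)
  have "norm (vector_derivative \<gamma> (at t)) = sqrt (\<Sum>i<k. 2 * (\<theta> i)\<^sup>2)" for t
    using vector_derivative_at[OF deriv] norm_plane_rotations_velocity[OF pairs]
    by (simp add: norm_orthogonal_matrix_mult[OF P] V_def)
  then have "curve_length frobenius_metric \<gamma> = sqrt (\<Sum>i<k. 2 * (\<theta> i)\<^sup>2)"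
    by (simp add: curve_length_frobenius)
  also have "\<dots> \<le> sqrt (real (2 * (CARD('n) div 2)) * pi\<^sup>2)"
  proof (rule real_sqrt_le_mono)
    have "(\<Sum>i<k. 2 * (\<theta> i)\<^sup>2) \<le> (\<Sum>i<k. 2 * pi\<^sup>2)"
      using \<theta> by (intro sum_mono) (simp add: power_mono)
    also have "\<dots> = real (2 * k) * pi\<^sup>2"
      by simp
    also have "\<dots> \<le> real (2 * (CARD('n) div 2)) * pi\<^sup>2"
      using orthonormal_pairs_card[OF pairs] by (intro mult_right_mono) auto
    finally show "(\<Sum>i<k. 2 * (\<theta> i)\<^sup>2) \<le> real (2 * (CARD('n) div 2)) * pi\<^sup>2" .
  qed
  also have "\<dots> = sqrt (real (2 * (CARD('n) div 2))) * pi"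
    by (simp add: real_sqrt_mult)
  finally show thesis
    using that C1 cont sub ends by blast
qed

section \<open>The two bounds for the distance and the diameter\<close>

lemma riemannian_dist_orthogonal_group_le:
  fixes P Q :: "real^'n^'n"
  assumes "connected_component orthogonal_group P Q"
  shows "riemannian_dist frobenius_metric orthogonal_group P Q \<le>
    ereal (sqrt (real (2 * (CARD('n) div 2))) * pi)"
proof -
  obtain T where T: "connected T" "T \<subseteq> orthogonal_group" "P \<in> T" "Q \<in> T"
    using assms by (auto simp: connected_component_def)
  then have "P \<in> orthogonal_group" "Q \<in> orthogonal_group" "det P = det Q"
    using det_eq_on_connected by blast+
  then obtain \<gamma> where "piecewise_C1_curve \<gamma>" "\<gamma> ` {0..1} \<subseteq> orthogonal_group" "\<gamma> 0 = P" "\<gamma> 1 = Q"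
    and le: "curve_length frobenius_metric \<gamma> \<le> sqrt (real (2 * (CARD('n) div 2))) * pi"
    by (rule orthogonal_group_short_curve)
  then have "riemannian_dist frobenius_metric orthogonal_group P Q \<le> ereal (curve_length frobenius_metric \<gamma>)"
    unfolding riemannian_dist_def by (intro Inf_lower) blast
  also have "\<dots> \<le> ereal (sqrt (real (2 * (CARD('n) div 2))) * pi)"
    using le by simp
  finally show ?thesis .
qed

text \<open>Take the identity and a diagonal matrix with as many entries -1 as an even number
  allows. Evenness gives determinant 1, and every competing curve takes each of the corresponding
  rows to its antipode.\<close>

lemma riemannian_dist_orthogonal_group_ge:
  obtains P Q :: "real^'n^'n" where "connected_component orthogonal_group P Q"
    "ereal (sqrt (real (2 * (CARD('n) div 2))) * pi) \<le> riemannian_dist frobenius_metric orthogonal_group P Q"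
proof -
  obtain S :: "'n set" where S: "card S = 2 * (CARD('n) div 2)"
    using obtain_subset_with_card_n[of "2 * (CARD('n) div 2)" "UNIV :: 'n set"] by auto
  define s where "s i = (if i \<in> S then - 1 else 1 :: real)" for i
  define Q :: "real^'n^'n" where "Q = (\<chi> i j. if i = j then s i else 0)"
  have "s i * s i = 1" for i
    by (simp add: s_def)
  then have "orthogonal_matrix Q"
    unfolding orthogonal_matrix
    by (auto simp: vec_eq_iff matrix_matrix_mult_def transpose_def mat_def Q_def if_distrib
        intro!: sum.neutral cong: if_cong)
  moreover have "det Q = 1"
  proof -
    have "det Q = (\<Prod>i\<in>UNIV. if i \<in> S then - 1 else 1)"
      by (subst det_diagonal) (auto simp: Q_def s_def intro!: prod.cong)
    also have "\<dots> = (\<Prod>i\<in>S. - 1)"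
      by (rule prod.mono_neutral_cong_right) auto
    also have "\<dots> = 1"
      by (simp add: S power_mult)
    finally show ?thesis .
  qed
  \<comment> \<open>This curve only serves to put \<open>mat 1\<close> and \<open>Q\<close> into one
    component; its length is irrelevant here.\<close>
  ultimately obtain \<gamma> :: "real \<Rightarrow> real^'n^'n" where \<gamma>: "continuous_on {0..1} \<gamma>"
    "\<gamma> ` {0..1} \<subseteq> orthogonal_group" "\<gamma> 0 = mat 1" "\<gamma> 1 = Q"
    using orthogonal_group_short_curve[of "mat 1" Q] by (auto simp: orthogonal_group_def orthogonal_matrix_id)
  have "connected (\<gamma> ` {0..1})"
    using \<gamma>(1) by (rule connected_continuous_image) simp
  moreover have "mat 1 \<in> \<gamma> ` {0..1}" "Q \<in> \<gamma> ` {0..1}"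
    using imageI[of 0 "{0..1}" \<gamma>] imageI[of 1 "{0..1}" \<gamma>] \<gamma> by simp_all
  ultimately have "connected_component orthogonal_group (mat 1) Q"
    unfolding connected_component_def using \<gamma>(2) by blast
  moreover have "ereal (sqrt (real (2 * (CARD('n) div 2))) * pi) \<le>
      riemannian_dist frobenius_metric orthogonal_group (mat 1) Q"
    unfolding riemannian_dist_def
  proof (rule Inf_greatest)
    fix l
    assume "l \<in> {ereal (curve_length frobenius_metric \<sigma>) |\<sigma> :: real \<Rightarrow> real^'n^'n.
        piecewise_C1_curve \<sigma> \<and> \<sigma> ` {0..1} \<subseteq> orthogonal_group \<and> \<sigma> 0 = mat 1 \<and> \<sigma> 1 = Q}"
    then obtain \<sigma> :: "real \<Rightarrow> real^'n^'n" where l: "l = ereal (curve_length frobenius_metric \<sigma>)"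
      and "piecewise_C1_curve \<sigma>" "\<sigma> ` {0..1} \<subseteq> orthogonal_group" "\<sigma> 0 = mat 1" "\<sigma> 1 = Q"
      by blast
    then have "sqrt (real (card S)) * pi \<le> curve_length frobenius_metric \<sigma>"
      by (intro curve_length_flip_coordinates_ge) (auto simp: mat_def Q_def s_def)
    then show "ereal (sqrt (real (2 * (CARD('n) div 2))) * pi) \<le> l"
      by (simp add: S l)
  qed
  ultimately show thesis
    by (rule that)
qed

theorem corollary4p12:
  "riemannian_diameter frobenius_metric (orthogonal_group :: (real^'n^'n) set) =
     ereal (sqrt (2 * of_int \<lfloor>real CARD('n) / 2\<rfloor>) * pi)"
proof -
  have "2 * real_of_int \<lfloor>real CARD('n) / 2\<rfloor> = real (2 * (CARD('n) div 2))"
    using floor_divide_of_nat_eq[of "CARD('n)" 2, where 'a = real] by simp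
  moreover have "riemannian_diameter frobenius_metric (orthogonal_group :: (real^'n^'n) set) =
     ereal (sqrt (real (2 * (CARD('n) div 2))) * pi)"
    unfolding riemannian_diameter_def
  proof (rule antisym)
    show "Sup {riemannian_dist frobenius_metric orthogonal_group P Q |P Q :: real^'n^'n.
        connected_component orthogonal_group P Q} \<le> ereal (sqrt (real (2 * (CARD('n) div 2))) * pi)"
      by (rule Sup_least, clarify, rule riemannian_dist_orthogonal_group_le)
    obtain P Q :: "real^'n^'n" where "connected_component orthogonal_group P Q"
      "ereal (sqrt (real (2 * (CARD('n) div 2))) * pi) \<le> riemannian_dist frobenius_metric orthogonal_group P Q"
      by (rule riemannian_dist_orthogonal_group_ge)
    then show "ereal (sqrt (real (2 * (CARD('n) div 2))) * pi) \<le>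
        Sup {riemannian_dist frobenius_metric orthogonal_group P Q |P Q :: real^'n^'n.
          connected_component orthogonal_group P Q}"
      by (intro Sup_upper2) auto
  qed
  ultimately show ?thesis
    by simp
qed

end
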